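(* Let $k$ be an algebraically closed field of characteristic $0$ and $\alpha$ a $k$-valued pseudocharacter (pseudo-TQFT) of $\mathrm{Cob}_2$. Then $Z_\alpha(T)$ is rational and has one of the forms (1) $Z_\alpha=\mu+mT+\sum_{i=1}^s\frac{m_i\lambda_i^{-1}}{1-\lambda_iT}$ with $\mu\in k$, $m\in\{2,3,\dots\}$, $s\ge0$, $m_i\in\{1,2,\dots\}$, $\lambda_i\in k^\times$; (2) $Z_\alpha=\sum_{i=1}^s\frac{m_i\lambda_i^{-1}}{1-\lambda_iT}$ with $s\ge0$, $m_i\in\{1,2,\dots\}$, $\lambda_i\in k^\times$. In particular there exists a finite-dimensional commutative Frobenius algebra $(B,\varepsilon)$ over $k$ (possibly zero) such that $\alpha(S_g)=\varepsilon(h_B^g)$ for all $g\ge0$, i.e. $\alpha$ is the restriction to closed surfaces of the two-dimensional TQFT determined by $(B,\varepsilon)$.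
   Context: $\mathrm{Cob}_2$ is the rigid symmetric monoidal category of oriented two-dimensional cobordisms between closed oriented one-manifolds, with unit the empty manifold $\emptyset$. An evaluation is a monoid homomorphism $\alpha:\mathrm{End}_{\mathrm{Cob}_2}(\emptyset)\to k$ ($\alpha(\emptyset)=1$, multiplicative on disjoint unions); it is determined by $\alpha_g:=\alpha(S_g)$, $S_g$ the closed connected oriented genus-$g$ surface, and $Z_\alpha(T)=\sum_{g\ge0}\alpha_gT^g$ (rational functions identified with their expansions at $T=0$). Extend $\alpha$ linearly. For an object $N$ and $n\ge1$, $e^-_{N,n}=\sum_{\sigma\in S_n}\mathrm{sgn}(\sigma)\sigma\in k\,\mathrm{End}(N^{\sqcup n})$ via permutation cobordisms; $\mathrm{cl}(f)$ denotes the closure (categorical trace) of an endomorphism $f$. $\deg_\alpha(N)$ is the least $d\ge0$ with $\alpha(\mathrm{cl}(h\circ e^-_{N,d+1}))=0$ for all $h\in\mathrm{End}_{\mathrm{Cob}_2}(N^{\sqcup(d+1)})$ ($\infty$ if none); $\alpha$ is a pseudocharacter of $\mathrm{Cob}_2$ if $\deg_\alpha(N)<\infty$ for every object $N$. A commutative Frobenius algebra $(B,\varepsilon)$ is a finite-dimensional commutative $k$-algebra with $k$-linear $\varepsilon:B\to k$ such that $(x,y)\mapsto\varepsilon(xy)$ is nondegenerate; its handle element is $h_B=\sum_iu_iv_i$ for a basis $\{u_i\}$ and dual basis $\{v_i\}$ with $\varepsilon(u_iv_j)=\delta_{ij}$. *)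

theory Defs
  imports "HOL-Computational_Algebra.Computational_Algebra" "HOL-Combinatorics.Permutations"
begin

text \<open>
  An object of Cob_2 is (up to isomorphism) a disjoint union of p circles.
  An endomorphism h of p circles is encoded by (b, gen, cl): the boundary circles are
  indexed by 0..p-1 (incoming) and p..2p-1 (outgoing); b assigns to each boundary circle
  the label of the connected component containing it; gen gives the genus of each labelled
  component; cl is the list of genera of the closed components.  Every oriented
  cobordism arises this way (classification of surfaces).
  The closure of h composed with a permutation cobordism s glues outgoing circle j to
  incoming circle s j.  The resulting closed surface has one component for each connected
  component C of the gluing graph, of genus (sum of genera in C) + (#edges in C) + 1 - card C.
\<close>

definition glue_adj :: "nat \<Rightarrow> (nat \<Rightarrow> nat) \<Rightarrow> (nat \<Rightarrow> nat) \<Rightarrow> nat \<Rightarrow> nat \<Rightarrow> bool" where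
  "glue_adj p b s x y \<longleftrightarrow>
     (\<exists>j<p. (x = b (p + j) \<and> y = b (s j)) \<or> (y = b (p + j) \<and> x = b (s j)))"

definition glue_comps :: "nat \<Rightarrow> (nat \<Rightarrow> nat) \<Rightarrow> (nat \<Rightarrow> nat) \<Rightarrow> nat set set" where
  "glue_comps p b s =
     {{y \<in> b ` {..<2*p}. (glue_adj p b s)\<^sup>*\<^sup>* x y} | x. x \<in> b ` {..<2*p}}"

definition comp_genus :: "nat \<Rightarrow> (nat \<Rightarrow> nat) \<Rightarrow> (nat \<Rightarrow> nat) \<Rightarrow> nat set \<Rightarrow> nat" where
  "comp_genus p b gen C = (\<Sum>v\<in>C. gen v) + card {j. j < p \<and> b (p + j) \<in> C} + 1 - card C"

text \<open>alpha(cl(h o s)) for the evaluation with alpha(S_g) = a g (multiplicative on components).\<close>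
definition closure_eval ::
  "(nat \<Rightarrow> 'k::comm_ring_1) \<Rightarrow> nat \<Rightarrow> (nat \<Rightarrow> nat) \<Rightarrow> (nat \<Rightarrow> nat) \<Rightarrow> nat list \<Rightarrow> (nat \<Rightarrow> nat) \<Rightarrow> 'k" where
  "closure_eval a p b gen cl s =
     (\<Prod>C\<in>glue_comps p b s. a (comp_genus p b gen C)) * (\<Prod>g\<leftarrow>cl. a g)"

text \<open>The permutation cobordism of N^(d+1), N = n circles, permuting the d+1 copies by s.\<close>
definition block_perm :: "nat \<Rightarrow> (nat \<Rightarrow> nat) \<Rightarrow> nat \<Rightarrow> nat" where
  "block_perm n s i = s (i div n) * n + i mod n"

text \<open>deg_alpha(N) < infinity for all objects N (N = n circles).\<close>
definition pseudocharacter :: "(nat \<Rightarrow> 'k::comm_ring_1) \<Rightarrow> bool" where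
  "pseudocharacter a \<longleftrightarrow>
     (\<forall>n. \<exists>d. \<forall>b gen cl.
        (\<Sum>s | s permutes {..<Suc d}.
            of_int (sign s) * closure_eval a (n * Suc d) b gen cl (block_perm n s)) = 0)"

definition vec_on :: "nat \<Rightarrow> (nat \<Rightarrow> 'k::zero) \<Rightarrow> bool" where
  "vec_on n x \<longleftrightarrow> (\<forall>i\<ge>n. x i = 0)"

definition basis_vec :: "nat \<Rightarrow> nat \<Rightarrow> 'k::{zero,one}" where
  "basis_vec i = (\<lambda>j. if j = i then 1 else 0)"

definition fa_mul :: "nat \<Rightarrow> (nat \<Rightarrow> nat \<Rightarrow> nat \<Rightarrow> 'k::field) \<Rightarrow> (nat \<Rightarrow> 'k) \<Rightarrow> (nat \<Rightarrow> 'k) \<Rightarrow> nat \<Rightarrow> 'k" where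
  "fa_mul n c x y = (\<lambda>l. if l < n then (\<Sum>i<n. \<Sum>j<n. x i * y j * c i j l) else 0)"

definition fa_eps :: "nat \<Rightarrow> (nat \<Rightarrow> 'k::field) \<Rightarrow> (nat \<Rightarrow> 'k) \<Rightarrow> 'k" where
  "fa_eps n t x = (\<Sum>i<n. t i * x i)"

definition comm_frobenius ::
  "nat \<Rightarrow> (nat \<Rightarrow> nat \<Rightarrow> nat \<Rightarrow> 'k::field) \<Rightarrow> (nat \<Rightarrow> 'k) \<Rightarrow> (nat \<Rightarrow> 'k) \<Rightarrow> bool" where
  "comm_frobenius n c e t \<longleftrightarrow>
     vec_on n e \<and>
     (\<forall>i<n. \<forall>j<n. \<forall>l<n. c i j l = c j i l) \<and>
     (\<forall>x y z. vec_on n x \<longrightarrow> vec_on n y \<longrightarrow> vec_on n z \<longrightarrow>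
        fa_mul n c (fa_mul n c x y) z = fa_mul n c x (fa_mul n c y z)) \<and>
     (\<forall>x. vec_on n x \<longrightarrow> fa_mul n c e x = x) \<and>
     (\<forall>x. vec_on n x \<longrightarrow> (\<forall>y. vec_on n y \<longrightarrow> fa_eps n t (fa_mul n c x y) = 0) \<longrightarrow> x = (\<lambda>_. 0))"

definition is_handle ::
  "nat \<Rightarrow> (nat \<Rightarrow> nat \<Rightarrow> nat \<Rightarrow> 'k::field) \<Rightarrow> (nat \<Rightarrow> 'k) \<Rightarrow> (nat \<Rightarrow> 'k) \<Rightarrow> bool" where
  "is_handle n c t h \<longleftrightarrow>
     (\<exists>v. (\<forall>i<n. vec_on n (v i)) \<and>
          (\<forall>i<n. \<forall>j<n. fa_eps n t (fa_mul n c (basis_vec i) (v j)) = (if i = j then 1 else 0)) \<and>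
          h = (\<lambda>l. \<Sum>i<n. fa_mul n c (basis_vec i) (v i) l))"

definition fa_pow :: "nat \<Rightarrow> (nat \<Rightarrow> nat \<Rightarrow> nat \<Rightarrow> 'k::field) \<Rightarrow> (nat \<Rightarrow> 'k) \<Rightarrow> (nat \<Rightarrow> 'k) \<Rightarrow> nat \<Rightarrow> nat \<Rightarrow> 'k" where
  "fa_pow n c e h g = (fa_mul n c h ^^ g) e"

end

(*
Write L for the functional x^g \<mapsto> a g on polynomials in the handle operator x.  Only the object
"one circle" and endomorphisms consisting of one pair of disks and some tubes are needed.
Adding an identity tube multiplies the alternating sum by (a 1 - number of circles), so a 1 is a
natural number t and the alternating sums already vanish on t + 1 circles.  For t tubes of genus one
and one pair of disks this vanishing is the Cayley-Hamilton identity L (x^u chi) = 0 for all u \<ge> 0,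
where chi is monic of degree t with coefficients tied to the values a (g + 1) by Newton's identities.
The instances u \<ge> 1 make a (g + 1) the power sums of the roots of chi.
The instance u = 0 gives the condition at the root 0, of multiplicity m: it excludes m = 1,
and forces mu = 0 when m = 0.
*)
theory Submission
  imports Defs
begin

section \<open>Alternating sums over one pair of disks and tubes\<close>

text \<open>Slot \<open>0\<close> carries two disks, the incoming one with label \<open>1\<close> and the outgoing one with
  label \<open>0\<close> and genus \<open>0\<close>; any other slot \<open>j\<close> carries a tube with label \<open>Suc j\<close>.\<close>

definition out_label :: "nat \<Rightarrow> nat" where
  "out_label j = (if j = 0 then 0 else Suc j)"

definition slot_genus :: "(nat \<Rightarrow> nat) \<Rightarrow> nat \<Rightarrow> nat" where
  "slot_genus x v = (case v of 0 \<Rightarrow> 0 | Suc j \<Rightarrow> x j)"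

text \<open>The counterpart of \<open>glue_adj\<close> for this fixed labelling. The slots form an
  arbitrary set rather than an initial segment, so that an induction can remove any one of
  them.\<close>

definition slot_adj :: "nat set \<Rightarrow> (nat \<Rightarrow> nat) \<Rightarrow> nat \<Rightarrow> nat \<Rightarrow> bool" where
  "slot_adj S s u v \<longleftrightarrow>
     (\<exists>j\<in>S. (u = out_label j \<and> v = Suc (s j)) \<or> (v = out_label j \<and> u = Suc (s j)))"

definition slot_labels :: "nat set \<Rightarrow> nat set" where
  "slot_labels S = Suc ` S \<union> out_label ` S"

definition slot_comp :: "nat set \<Rightarrow> (nat \<Rightarrow> nat) \<Rightarrow> nat \<Rightarrow> nat set" where
  "slot_comp S s u = {v \<in> slot_labels S. (slot_adj S s)\<^sup>*\<^sup>* u v}"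

definition slot_comp_genus :: "nat set \<Rightarrow> (nat \<Rightarrow> nat) \<Rightarrow> nat set \<Rightarrow> nat" where
  "slot_comp_genus S x C =
     (\<Sum>v\<in>C. slot_genus x v) + card {j \<in> S. out_label j \<in> C} + 1 - card C"

definition slot_eval :: "(nat \<Rightarrow> 'k::comm_ring_1) \<Rightarrow> nat set \<Rightarrow> (nat \<Rightarrow> nat) \<Rightarrow> (nat \<Rightarrow> nat) \<Rightarrow> 'k" where
  "slot_eval a S x s = (\<Prod>C\<in>slot_comp S s ` slot_labels S. a (slot_comp_genus S x C))"

definition alt_eval :: "(nat \<Rightarrow> 'k::comm_ring_1) \<Rightarrow> nat set \<Rightarrow> (nat \<Rightarrow> nat) \<Rightarrow> 'k" where
  "alt_eval a S x = (\<Sum>s | s permutes S. of_int (sign s) * slot_eval a S x s)"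

section \<open>Gluing graphs with one tube added\<close>

lemma slot_adj_sym: "slot_adj S s u v \<Longrightarrow> slot_adj S s v u"
  by (auto simp: slot_adj_def)

lemma slot_adj_star_sym: "(slot_adj S s)\<^sup>*\<^sup>* u v \<Longrightarrow> (slot_adj S s)\<^sup>*\<^sup>* v u"
  using symp_rtranclp[of "slot_adj S s"] by (auto simp: symp_def slot_adj_sym)

lemma slot_labels_insert:
  assumes "c \<noteq> 0"
  shows "slot_labels (insert c S) = insert (Suc c) (slot_labels S)"
  using assms by (auto simp: slot_labels_def out_label_def)

lemma finite_slot_labels: "finite S \<Longrightarrow> finite (slot_labels S)"
  by (simp add: slot_labels_def)

lemma Suc_notin_slot_labels:
  assumes "c \<notin> S"
  shows "Suc c \<notin> slot_labels S"
  using assms by (auto simp: slot_labels_def out_label_def)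

text \<open>A tube glued to itself is an isolated vertex with one loop, hence a closed component of
  genus \<open>x c + 1 + 1 - 1\<close>. No other component changes.\<close>

lemma slot_eval_fix:
  fixes a :: "nat \<Rightarrow> 'k::comm_ring_1"
  assumes fin: "finite S" and c: "c \<noteq> 0" "c \<notin> S" and q: "q permutes S"
  shows "slot_eval a (insert c S) x q = a (x c + 1) * slot_eval a S x q"
proof -
  let ?R = "(slot_adj S q)\<^sup>*\<^sup>*" and ?R' = "(slot_adj (insert c S) q)\<^sup>*\<^sup>*"
  define V where "V = slot_labels S"
  have qc: "q c = c" using q c permutes_not_in by metis
  have v: "Suc c \<notin> V" using Suc_notin_slot_labels c V_def by auto
  have adj: "slot_adj (insert c S) q u w \<longleftrightarrow> slot_adj S q u w \<or> (u = Suc c \<and> w = Suc c)" for u w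
    using c by (auto simp: slot_adj_def qc out_label_def)
  have R1: "?R' u w" if "?R u w" for u w
    using that by (rule rtranclp_mono[THEN predicate2D, rotated]) (auto simp: adj)
  have R2: "?R u w" if "?R' u w" for u w
    using that by induction (auto simp: adj intro: rtranclp.rtrancl_into_rtrancl)
  have R: "?R' u w \<longleftrightarrow> ?R u w" for u w using R1 R2 by blast
  have inV: "w \<in> V" if "slot_adj S q u w" for u w
    using that permutes_in_image[OF q] by (auto simp: slot_adj_def V_def slot_labels_def)
  have stay: "w = Suc c" if "?R (Suc c) w" for w
    using that
  proof (induction)
    case (step y z)
    then show ?case using slot_adj_sym[of S q y z] inV[of z y] v by auto
  qed simp
  have comp: "slot_comp (insert c S) q u = slot_comp S q u" if "u \<in> V" for u
    using that v stay slot_adj_star_sym[of S q u "Suc c"] c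
    by (auto simp: slot_comp_def R slot_labels_insert V_def)
  have compv: "slot_comp (insert c S) q (Suc c) = {Suc c}"
    using c stay by (auto simp: slot_comp_def R slot_labels_insert)
  have comps: "slot_comp (insert c S) q ` slot_labels (insert c S) = insert {Suc c} (slot_comp S q ` V)"
    using c comp compv by (auto simp: slot_labels_insert V_def)
  have notin: "{Suc c} \<notin> slot_comp S q ` V"
    using v by (auto simp: slot_comp_def V_def)
  have g0: "slot_comp_genus (insert c S) x {Suc c} = x c + 1"
  proof -
    have "{j \<in> insert c S. out_label j \<in> {Suc c}} = {c}"
      using c by (auto simp: out_label_def split: if_splits)
    then show ?thesis by (simp add: slot_comp_genus_def slot_genus_def)
  qed
  have g1: "slot_comp_genus (insert c S) x C = slot_comp_genus S x C" if "C \<subseteq> V" for C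
  proof -
    have "{j \<in> insert c S. out_label j \<in> C} = {j \<in> S. out_label j \<in> C}"
      using c that v by (auto simp: out_label_def split: if_splits)
    then show ?thesis by (simp add: slot_comp_genus_def)
  qed
  have "slot_eval a (insert c S) x q =
      a (x c + 1) * (\<Prod>C\<in>slot_comp S q ` V. a (slot_comp_genus (insert c S) x C))"
    unfolding slot_eval_def comps
    by (subst prod.insert) (use fin notin g0 in \<open>auto simp: V_def finite_slot_labels\<close>)
  also have "(\<Prod>C\<in>slot_comp S q ` V. a (slot_comp_genus (insert c S) x C)) = slot_eval a S x q"
    unfolding slot_eval_def V_def
    by (intro prod.cong refl arg_cong[where f=a] g1) (auto simp: slot_comp_def V_def)
  finally show ?thesis .
qed

text \<open>The tube \<open>c\<close> subdivides the edge that \<open>q\<close> draws into slot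
  \<open>j\<close>. The extra edge and the extra vertex cancel in the genus formula, so only the
  genus \<open>x c\<close> survives; it is booked at the vertex \<open>Suc j\<close>, the incoming
  end of slot \<open>j\<close>.\<close>

lemma slot_eval_splice:
  fixes a :: "nat \<Rightarrow> 'k::comm_ring_1"
  assumes fin: "finite S" and c: "c \<noteq> 0" "c \<notin> S" and q: "q permutes S" and j: "j \<in> S"
  shows "slot_eval a (insert c S) x (transpose c j \<circ> q) = slot_eval a S (x(j := x j + x c)) q"
proof -
  define s where "s = transpose c j \<circ> q"
  let ?R = "(slot_adj S q)\<^sup>*\<^sup>*" and ?R' = "(slot_adj (insert c S) s)\<^sup>*\<^sup>*"
  define V where "V = slot_labels S"
  define x' where "x' = x(j := x j + x c)"
  define k where "k = inv q j"
  have qk: "q k = j" unfolding k_def using q permutes_inverses(1) by metis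
  have kS: "k \<in> S" using j qk permutes_in_image[OF q, of k] by simp
  have qc: "q c = c" using q c permutes_not_in by metis
  have sc: "s c = j" by (simp add: s_def qc)
  have sk: "s k = c" by (simp add: s_def qk)
  have si: "s i = q i" if "i \<in> S" "i \<noteq> k" for i
  proof -
    have "q i \<noteq> j" using that qk permutes_inj[OF q] by (metis injD)
    moreover have "q i \<noteq> c" using that permutes_in_image[OF q, of i] c by metis
    ultimately show ?thesis by (simp add: s_def transpose_def)
  qed
  have v: "Suc c \<notin> V" using Suc_notin_slot_labels c V_def by auto
  have outc: "out_label c = Suc c" using c by (simp add: out_label_def)
  have jV: "Suc j \<in> V" using j by (simp add: V_def slot_labels_def)
  have cj: "?R' (Suc c) (Suc j)"
    by (rule r_into_rtranclp) (auto simp: slot_adj_def outc sc)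
  have kc: "?R' (out_label k) (Suc c)"
    by (rule r_into_rtranclp) (use kS in \<open>auto simp: slot_adj_def sk\<close>)
  have R1: "?R' u w" if "slot_adj S q u w" for u w
  proof -
    from that obtain i where i: "i \<in> S"
      and uw: "(u = out_label i \<and> w = Suc (q i)) \<or> (w = out_label i \<and> u = Suc (q i))"
      by (auto simp: slot_adj_def)
    have "?R' (out_label i) (Suc (q i))"
    proof (cases "i = k")
      case True
      then show ?thesis using rtranclp_trans[OF kc cj] qk by simp
    next
      case False
      then show ?thesis
        by (intro r_into_rtranclp) (use i si in \<open>auto simp: slot_adj_def\<close>)
    qed
    then show ?thesis using uw slot_adj_star_sym by blast
  qed
  have R1: "?R' u w" if "?R u w" for u w
    using that by induction (use R1 in \<open>auto intro: rtranclp_trans\<close>)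
  \<comment> \<open>Contracting the new vertex onto \<open>Suc j\<close> sends walks of the larger
    graph to walks of the smaller one.\<close>
  define \<phi> where "\<phi> u = (if u = Suc c then Suc j else u)" for u
  have \<phi>V: "\<phi> u = u" if "u \<in> V" for u using that v by (auto simp: \<phi>_def)
  have labV: "out_label i \<in> V" "Suc i \<in> V" if "i \<in> S" for i
    using that by (auto simp: V_def slot_labels_def)
  have edge: "?R (\<phi> (out_label i)) (\<phi> (Suc (s i)))" if i: "i \<in> insert c S" for i
  proof -
    consider "i = c" | "i = k" | "i \<in> S" "i \<noteq> k" "i \<noteq> c" using i by blast
    then show ?thesis
    proof cases
      case 1
      then show ?thesis using jV by (simp add: outc sc \<phi>_def)
    next
      case 2
      have "slot_adj S q (out_label k) (Suc j)" using kS qk by (auto simp: slot_adj_def)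
      then show ?thesis using 2 labV(1)[OF kS] \<phi>V by (simp add: sk) (simp add: \<phi>_def)
    next
      case 3
      have "slot_adj S q (out_label i) (Suc (q i))" using 3 by (auto simp: slot_adj_def)
      moreover have "q i \<in> S" using 3 permutes_in_image[OF q] by simp
      ultimately show ?thesis using 3 labV \<phi>V si by simp
    qed
  qed
  have R2: "?R (\<phi> u) (\<phi> w)" if "?R' u w" for u w
    using that
  proof induction
    case (step y z)
    from step(2) obtain i where "i \<in> insert c S"
      and "(y = out_label i \<and> z = Suc (s i)) \<or> (z = out_label i \<and> y = Suc (s i))"
      by (auto simp: slot_adj_def)
    with edge[of i] slot_adj_star_sym[OF edge[of i]] have "?R (\<phi> y) (\<phi> z)" by auto
    with step show ?case by (meson rtranclp_trans)
  qed simp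
  have R: "?R' u w \<longleftrightarrow> ?R u w" if "u \<in> V" "w \<in> V" for u w
    using R1 R2[of u w] that \<phi>V by auto
  have Rv: "?R' u (Suc c) \<longleftrightarrow> ?R u (Suc j)" if "u \<in> V" for u
    using R2[of u "Suc c"] \<phi>V[OF that] R1[of u "Suc j"] slot_adj_star_sym[OF cj] 
    by (auto simp: \<phi>_def split: if_splits intro: rtranclp_trans)
  \<comment> \<open>The bijection between components: the new vertex joins the component of
    \<open>Suc j\<close>.\<close>
  define g where "g C = (if Suc j \<in> C then insert (Suc c) C else C)" for C
  have comp: "slot_comp (insert c S) s u = g (slot_comp S q u)" if "u \<in> V" for u
    using that jV c R Rv by (auto simp: slot_comp_def g_def slot_labels_insert V_def)
  have "slot_comp (insert c S) s (Suc c) = slot_comp (insert c S) s (Suc j)"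
    unfolding slot_comp_def using cj slot_adj_star_sym[OF cj] by (auto intro: rtranclp_trans)
  with comp[OF jV] have compv: "slot_comp (insert c S) s (Suc c) = g (slot_comp S q (Suc j))" by simp
  have comps: "slot_comp (insert c S) s ` slot_labels (insert c S) = g ` slot_comp S q ` V"
    using c comp compv jV by (auto simp: slot_labels_insert V_def[symmetric])
  have sub: "C \<subseteq> V" if "C \<in> slot_comp S q ` V" for C
    using that by (auto simp: slot_comp_def V_def)
  have inj: "inj_on g (slot_comp S q ` V)"
  proof (rule inj_onI)
    fix C D assume "C \<in> slot_comp S q ` V" "D \<in> slot_comp S q ` V" "g C = g D"
    then have "Suc c \<notin> C" "Suc c \<notin> D" "g C = g D" using sub v by blast+
    moreover have "C = g C - {Suc c}" if "Suc c \<notin> C" for C using that by (auto simp: g_def)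
    ultimately show "C = D" by metis
  qed
  have genus: "slot_comp_genus (insert c S) x (g C) = slot_comp_genus S x' C"
    if C: "C \<in> slot_comp S q ` V" for C
  proof -
    have CV: "C \<subseteq> V" using sub C .
    then have finC: "finite C" using fin finite_subset finite_slot_labels unfolding V_def by blast
    have vC: "Suc c \<notin> C" using CV v by blast
    have out: "out_label i \<noteq> Suc c" if "i \<in> S" for i using labV(1)[OF that] v by metis
    have gcong: "slot_genus x' w = slot_genus x w" if "w \<noteq> Suc j" for w
      using that by (auto simp: slot_genus_def x'_def split: nat.splits)
    show ?thesis
    proof (cases "Suc j \<in> C")
      case True
      have "{i \<in> insert c S. out_label i \<in> g C} = insert c {i \<in> S. out_label i \<in> C}"
        using True c out by (auto simp: g_def outc)
      then have cd: "card {i \<in> insert c S. out_label i \<in> g C} = Suc (card {i \<in> S. out_label i \<in> C})"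
        using c fin by simp
      have "(\<Sum>w\<in>g C. slot_genus x w) = x c + (\<Sum>w\<in>C. slot_genus x w)"
        using True vC finC by (simp add: g_def slot_genus_def)
      also have "\<dots> = (\<Sum>w\<in>C. slot_genus x' w)"
        unfolding sum.remove[OF finC True]
        by (simp add: gcong) (simp add: slot_genus_def x'_def)
      finally show ?thesis using True vC finC cd by (simp add: slot_comp_genus_def g_def)
    next
      case False
      have "{i \<in> insert c S. out_label i \<in> g C} = {i \<in> S. out_label i \<in> C}"
        using False c out vC by (auto simp: g_def outc)
      moreover have "(\<Sum>w\<in>C. slot_genus x w) = (\<Sum>w\<in>C. slot_genus x' w)"
        by (intro sum.cong refl) (use False gcong in metis)
      ultimately show ?thesis using False by (simp add: slot_comp_genus_def g_def)
    qed
  qed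
  have "slot_eval a (insert c S) x s = (\<Prod>C\<in>slot_comp S q ` V. a (slot_comp_genus (insert c S) x (g C)))"
    unfolding slot_eval_def comps by (subst prod.reindex[OF inj]) simp
  also have "\<dots> = slot_eval a S x' q"
    unfolding slot_eval_def V_def[symmetric] by (intro prod.cong refl arg_cong[where f=a] genus)
  finally show ?thesis by (simp add: s_def x'_def)
qed

text \<open>Permutations fixing \<open>c\<close> close the tube up; for all others, removing \<open>c\<close> from its cycle
  flips the sign and adds the genus of the tube to the component entering slot \<open>j\<close>.\<close>

lemma alt_eval_tube:
  fixes a :: "nat \<Rightarrow> 'k::comm_ring_1"
  assumes fin: "finite S" and c: "c \<noteq> 0" "c \<notin> S"
  shows "alt_eval a (insert c S) x =
    a (x c + 1) * alt_eval a S x - (\<Sum>j\<in>S. alt_eval a S (x(j := x j + x c)))"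
proof -
  have sgn: "sign (transpose c j \<circ> q) = - sign q" if "j \<in> S" "q permutes S" for j q
  proof -
    have "permutation q" using that fin permutes_imp_permutation by blast
    moreover have "c \<noteq> j" using that c by blast
    ultimately show ?thesis by (simp add: sign_compose permutation_swap_id sign_swap_id)
  qed
  \<comment> \<open>A permutation of \<open>insert c S\<close> is uniquely
    \<open>transpose c j \<circ> q\<close> with \<open>j\<close> its value at \<open>c\<close>; the
    summand \<open>j = c\<close> collects those fixing \<open>c\<close>.\<close>
  have "alt_eval a (insert c S) x = (\<Sum>j\<in>insert c S. \<Sum>q | q permutes S.
      of_int (sign (transpose c j \<circ> q)) * slot_eval a (insert c S) x (transpose c j \<circ> q))"
    unfolding alt_eval_def by (rule sum_over_permutations_insert[OF fin c(2)])
  also have "\<dots> = (\<Sum>q | q permutes S. of_int (sign q) * slot_eval a (insert c S) x q) +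
      (\<Sum>j\<in>S. \<Sum>q | q permutes S.
      of_int (sign (transpose c j \<circ> q)) * slot_eval a (insert c S) x (transpose c j \<circ> q))"
    using fin c by (simp add: transpose_same)
  also have "(\<Sum>q | q permutes S. of_int (sign q) * slot_eval a (insert c S) x q) =
      a (x c + 1) * alt_eval a S x"
    unfolding alt_eval_def sum_distrib_left
    by (intro sum.cong refl) (simp add: slot_eval_fix[OF fin c] mult_ac)
  also have "(\<Sum>j\<in>S. \<Sum>q | q permutes S.
      of_int (sign (transpose c j \<circ> q)) * slot_eval a (insert c S) x (transpose c j \<circ> q)) =
      (\<Sum>j\<in>S. - alt_eval a S (x(j := x j + x c)))"
    unfolding alt_eval_def sum_negf[symmetric]
    by (intro sum.cong refl) (simp add: slot_eval_splice[OF fin c] sgn)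
  finally show ?thesis by (simp add: sum_negf)
qed

section \<open>Small cases and the link to pseudocharacters\<close>

lemma alt_eval_empty: "alt_eval a {} x = 1"
  by (simp add: alt_eval_def slot_eval_def slot_labels_def sign_id)

text \<open>Two vertices and one edge form a tree, so the genera of the two disks just add up, and
  the outgoing disk has genus 0.\<close>

lemma alt_eval_disk: "alt_eval a {0} x = a (x 0)"
proof -
  have "(slot_adj {0} id)\<^sup>*\<^sup>* 0 (Suc 0)" "(slot_adj {0} id)\<^sup>*\<^sup>* (Suc 0) 0"
    by (auto intro!: r_into_rtranclp simp: slot_adj_def out_label_def)
  moreover have L: "slot_labels {0} = {0, Suc 0}" by (auto simp: slot_labels_def out_label_def)
  ultimately have "slot_comp {0} id u = {0, Suc 0}" if "u \<in> {0, Suc 0}" for u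
    using that by (auto simp: slot_comp_def)
  then have "slot_comp {0} id ` slot_labels {0} = {{0, Suc 0}}" by (simp add: L)
  moreover have "{j \<in> {0}. out_label j \<in> {0, Suc 0}} = {0}" by (auto simp: out_label_def)
  ultimately show ?thesis
    by (simp add: alt_eval_def slot_eval_def slot_comp_genus_def slot_genus_def permutes_sing sign_id)
qed

lemma alt_eval_cong:
  assumes "\<And>j. j \<in> S \<Longrightarrow> x j = y j"
  shows "alt_eval a S x = alt_eval a S y"
proof -
  have g: "slot_genus x v = slot_genus y v" if "v \<in> slot_labels S" for v
    using that assms by (auto simp: slot_labels_def slot_genus_def out_label_def)
  have "slot_comp_genus S x C = slot_comp_genus S y C" if "C \<in> slot_comp S s ` slot_labels S" for s C
  proof -
    have "C \<subseteq> slot_labels S" using that by (auto simp: slot_comp_def)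
    then have "(\<Sum>v\<in>C. slot_genus x v) = (\<Sum>v\<in>C. slot_genus y v)" using g by (intro sum.cong) auto
    then show ?thesis by (simp add: slot_comp_genus_def)
  qed
  then show ?thesis by (simp add: alt_eval_def slot_eval_def cong: prod.cong)
qed

text \<open>For one circle the block permutations are the permutations themselves. Among the
  endomorphisms only a pair of disks with tubes, without closed components, is tested.\<close>

lemma pseudocharacter_alt_eval:
  assumes "pseudocharacter a"
  obtains d where "\<And>x. alt_eval a {..<Suc d} x = 0"
proof -
  from assms[unfolded pseudocharacter_def, rule_format, of 1] obtain d where
    d: "\<And>b gen cl. (\<Sum>s | s permutes {..<Suc d}.
      of_int (sign s) * closure_eval a (1 * Suc d) b gen cl (block_perm 1 s)) = 0" by blast
  define p where "p = Suc d"
  \<comment> \<open>Incoming circles get the labels \<open>Suc i\<close> and outgoing ones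
    \<open>out_label j\<close>, which turns \<open>glue_adj\<close> into
    \<open>slot_adj\<close>.\<close>
  define b where "b i = (if i < p then Suc i else out_label (i - p))" for i
  have b_in: "b j = Suc j" if "j < p" for j using that by (simp add: b_def)
  have b_out: "b (p + j) = out_label j" for j by (simp add: b_def)
  have "{..<2 * p} = {..<p} \<union> (+) p ` {..<p}"
    using image_add_atLeastLessThan[of p 0 p] by (auto simp: lessThan_atLeast0)
  then have labels: "b ` {..<2 * p} = slot_labels {..<p}"
    using image_cong[OF refl, of "{..<p}" b Suc] b_in
    by (simp add: slot_labels_def image_Un image_image b_out)
  have eval: "closure_eval a p b (slot_genus x) [] s = slot_eval a {..<p} x s"
    if s: "s permutes {..<p}" for x s
  proof -
    have "b (s j) = Suc (s j)" if "j < p" for j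
      using b_in permutes_in_image[OF s, of j] that by simp
    then have "glue_adj p b s = slot_adj {..<p} s"
      by (auto simp: fun_eq_iff glue_adj_def slot_adj_def b_out)
    then have "glue_comps p b s = slot_comp {..<p} s ` slot_labels {..<p}"
      unfolding glue_comps_def labels by (auto simp: slot_comp_def)
    then show ?thesis
      by (simp add: closure_eval_def slot_eval_def comp_genus_def slot_comp_genus_def b_out)
  qed
  have bp: "block_perm 1 s = s" for s by (simp add: block_perm_def fun_eq_iff)
  have "alt_eval a {..<p} x = 0" for x
  proof -
    have "alt_eval a {..<p} x = (\<Sum>s | s permutes {..<p}.
        of_int (sign s) * closure_eval a p b (slot_genus x) [] (block_perm 1 s))"
      unfolding alt_eval_def bp by (intro sum.cong refl) (simp add: eval)
    then show ?thesis using d[of b "slot_genus x" "[]"] by (simp add: p_def)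
  qed
  then show ?thesis by (intro that[of d]) (simp add: p_def)
qed

section \<open>Alternating sums with tubes of genus one\<close>

text \<open>A Laplace expansion at the incoming disk: glued to the outgoing disk it closes to
  \<open>a (x 0)\<close>, glued to a tube \<open>j\<close> it absorbs that tube. Induction on the
  tubes replaces a second study of gluing graphs: both sides are expanded at a tube \<open>b\<close>
  by \<open>alt_eval_tube\<close>.\<close>

lemma alt_eval_expand_disk:
  fixes a :: "nat \<Rightarrow> 'k::comm_ring_1"
  assumes "finite T" "0 \<notin> T"
  shows "alt_eval a (insert 0 T) x =
    a (x 0) * alt_eval a T x - (\<Sum>j\<in>T. alt_eval a (insert 0 (T - {j})) (x(0 := x 0 + x j)))"
  using assms
proof (induction T arbitrary: x rule: finite_induct)
  case empty
  then show ?case by (simp add: alt_eval_empty alt_eval_disk)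
next
  case (insert b T)
  define F where "F = alt_eval a"
  define mrg where "mrg x i j = x(i := x i + x j)" for x :: "nat \<Rightarrow> nat" and i j
  have b: "b \<noteq> 0" "b \<notin> T" and T0: "0 \<notin> T" and fin: "finite T" using insert by auto
  have IH: "F (insert 0 T) x = a (x 0) * F T x - (\<Sum>j\<in>T. F (insert 0 (T - {j})) (mrg x 0 j))" for x
    unfolding F_def mrg_def by (rule insert.IH[OF T0])
  have tube: "F (insert b S) x = a (x b + 1) * F S x - (\<Sum>j\<in>S. F S (mrg x j b))"
    if "finite S" "b \<notin> S" for S x
    using alt_eval_tube[OF that(1) b(1) that(2)] by (simp add: F_def mrg_def)
  have cut: "F (insert 0 (insert b T - {j})) (mrg x 0 j) =
      a (x b + 1) * F (insert 0 (T - {j})) (mrg x 0 j)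
      - (\<Sum>i\<in>T. F (insert 0 (T - {j})) (mrg (mrg x i b) 0 j))" if j: "j \<in> T" for j
  proof -
    have "mrg (mrg x 0 j) i b = mrg (mrg x i b) 0 j" if "i \<in> T - {j}" for i
      using that T0 b by (auto simp: mrg_def fun_eq_iff)
    then have "(\<Sum>i\<in>T-{j}. F (insert 0 (T - {j})) (mrg (mrg x 0 j) i b)) =
        (\<Sum>i\<in>T-{j}. F (insert 0 (T - {j})) (mrg (mrg x i b) 0 j))"
      by (intro sum.cong) auto
    \<comment> \<open>Splicing \<open>b\<close> into the disks after they absorbed \<open>j\<close>
      amounts to splicing \<open>b\<close> into \<open>j\<close> first. The two genus assignments
      differ only at \<open>j\<close>, which is no longer a slot. This supplies the summand
      \<open>i = j\<close>.\<close>
    moreover have "F (insert 0 (T - {j})) (mrg (mrg x 0 j) 0 b) = F (insert 0 (T - {j})) (mrg (mrg x j b) 0 j)"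
      unfolding F_def by (rule alt_eval_cong) (use T0 j b in \<open>auto simp: mrg_def\<close>)
    moreover have "mrg x 0 j b = x b" using b by (simp add: mrg_def)
    moreover have "insert 0 (insert b T - {j}) = insert b (insert 0 (T - {j}))" using b j by auto
    ultimately show ?thesis using tube[of "insert 0 (T - {j})" "mrg x 0 j"] fin b T0 j
      by (simp add: sum.remove[OF fin j])
  qed
  have "F (insert 0 (insert b T)) x =
      a (x b + 1) * F (insert 0 T) x - F (insert 0 T) (mrg x 0 b) - (\<Sum>j\<in>T. F (insert 0 T) (mrg x j b))"
    using tube[of "insert 0 T" x] fin b T0 by (simp add: insert_commute)
  also have "(\<Sum>j\<in>T. F (insert 0 T) (mrg x j b)) =
      (\<Sum>j\<in>T. a (x 0) * F T (mrg x j b) - (\<Sum>i\<in>T. F (insert 0 (T - {i})) (mrg (mrg x j b) 0 i)))"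
  proof (rule sum.cong[OF refl])
    fix j assume "j \<in> T"
    then have "mrg x j b 0 = x 0" using T0 by (auto simp: mrg_def)
    then show "F (insert 0 T) (mrg x j b) =
        a (x 0) * F T (mrg x j b) - (\<Sum>i\<in>T. F (insert 0 (T - {i})) (mrg (mrg x j b) 0 i))"
      by (simp add: IH)
  qed
  also have "\<dots> = a (x 0) * (\<Sum>j\<in>T. F T (mrg x j b)) -
      (\<Sum>i\<in>T. \<Sum>j\<in>T. F (insert 0 (T - {i})) (mrg (mrg x j b) 0 i))"
    unfolding sum_subtractf sum_distrib_left by (subst (2) sum.swap) simp
  also have "a (x b + 1) * F (insert 0 T) x - F (insert 0 T) (mrg x 0 b) - \<dots> =
      a (x 0) * F (insert b T) x - (\<Sum>j\<in>insert b T. F (insert 0 (insert b T - {j})) (mrg x 0 j))"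
    using fin b by (simp add: IH[of x] tube cut sum_subtractf sum_distrib_left[symmetric] algebra_simps)
  finally show ?case unfolding F_def mrg_def .
qed

text \<open>The value of \<open>alt_eval\<close> on \<open>q\<close> tubes of genus one and a pair of disks of total genus \<open>u\<close>.\<close>

fun disk_eval :: "(nat \<Rightarrow> 'k::comm_ring_1) \<Rightarrow> nat \<Rightarrow> nat \<Rightarrow> 'k" where
  "disk_eval a 0 u = a u"
| "disk_eval a (Suc q) u = a u * disk_eval a q 2 - of_nat (Suc q) * disk_eval a q (u + 1)"

text \<open>Closing the tube \<open>b\<close> costs one more genus than gluing two disks, so
  \<open>x b + 1\<close> takes the place of the total genus. Once \<open>b\<close> is closed off,
  another tube of genus one plays its role, whence the argument \<open>2\<close>.\<close>

lemma alt_eval_tubes: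
  fixes a :: "nat \<Rightarrow> 'k::comm_ring_1"
  assumes "finite T" "0 \<notin> T" "b \<noteq> 0" "b \<notin> T" "\<And>j. j \<in> T \<Longrightarrow> x j = 1"
  shows "alt_eval a (insert b T) x = disk_eval a (card T) (x b + 1)"
  using assms
proof (induction "card T" arbitrary: T b x)
  case 0
  then show ?case using alt_eval_tube[of "{}" b a x] by (simp add: alt_eval_empty)
next
  case (Suc q)
  have T: "alt_eval a T x = disk_eval a q 2"
  proof -
    obtain c where c: "c \<in> T" using Suc.hyps(2) by (metis card_eq_SucD insertI1)
    have "alt_eval a (insert c (T - {c})) x = disk_eval a (card (T - {c})) (x c + 1)"
      by (rule Suc.hyps(1)) (use Suc c in \<open>auto simp: card_Diff_singleton intro: gr0I\<close>)
    then show ?thesis using Suc.prems c Suc.hyps(2)[symmetric] by (simp add: insert_absorb numeral_2_eq_2)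
  qed
  have "alt_eval a T (x(j := x j + x b)) = disk_eval a q (x b + 1 + 1)" if j: "j \<in> T" for j
  proof -
    have "alt_eval a (insert j (T - {j})) (x(j := x j + x b)) =
        disk_eval a (card (T - {j})) ((x(j := x j + x b)) j + 1)"
      by (rule Suc.hyps(1)) (use Suc j in \<open>auto simp: card_Diff_singleton intro: gr0I\<close>)
    then show ?thesis using Suc.prems j Suc.hyps(2)[symmetric] by (simp add: insert_absorb)
  qed
  then show ?case using alt_eval_tube[of T b a x] Suc.prems T Suc.hyps(2)[symmetric] by simp
qed

text \<open>The recursion of \<open>disk_eval\<close> is the expansion at the incoming disk: each
  absorbed tube raises the genus of the pair by one, and all tubes contribute equally.\<close>

lemma alt_eval_disk_tubes:
  fixes a :: "nat \<Rightarrow> 'k::comm_ring_1"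
  assumes "finite T" "0 \<notin> T" "\<And>j. j \<in> T \<Longrightarrow> x j = 1"
  shows "alt_eval a (insert 0 T) x = disk_eval a (card T) (x 0)"
  using assms
proof (induction "card T" arbitrary: T x)
  case 0
  then show ?case by (simp add: alt_eval_disk)
next
  case (Suc q)
  have T: "alt_eval a T x = disk_eval a q 2"
  proof -
    obtain c where c: "c \<in> T" using Suc.hyps(2) by (metis card_eq_SucD insertI1)
    have "alt_eval a (insert c (T - {c})) x = disk_eval a (card (T - {c})) (x c + 1)"
      by (rule alt_eval_tubes) (use Suc c in \<open>auto intro: gr0I\<close>)
    then show ?thesis using Suc.prems c Suc.hyps(2)[symmetric] by (simp add: insert_absorb numeral_2_eq_2)
  qed
  have "alt_eval a (insert 0 (T - {j})) (x(0 := x 0 + x j)) = disk_eval a q (x 0 + 1)" if j: "j \<in> T" for j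
  proof -
    have "alt_eval a (insert 0 (T - {j})) (x(0 := x 0 + x j)) =
        disk_eval a (card (T - {j})) ((x(0 := x 0 + x j)) 0)"
      by (rule Suc.hyps(1)) (use Suc j in \<open>auto simp: card_Diff_singleton\<close>)
    then show ?thesis using Suc.prems j Suc.hyps(2)[symmetric] by simp
  qed
  then show ?case using alt_eval_expand_disk[of T a x] Suc.prems T Suc.hyps(2)[symmetric] by simp
qed

section \<open>Descent in the number of circles\<close>

text \<open>Closing the tube gives a torus, hence the factor \<open>a 1\<close>. Splicing a tube of
  genus 0 into a slot changes nothing, so each slot subtracts one copy.\<close>

lemma alt_eval_identity_tube:
  fixes a :: "nat \<Rightarrow> 'k::comm_ring_1"
  assumes "finite S" "c \<noteq> 0" "c \<notin> S" "x c = 0"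
  shows "alt_eval a (insert c S) x = (a 1 - of_nat (card S)) * alt_eval a S x"
  using assms by (simp add: alt_eval_tube algebra_simps)

text \<open>Vanishing descends from \<open>p + 2\<close> to \<open>p + 1\<close> slots by cancelling
  the factor \<open>a 1 - of_nat (p + 1)\<close>. This is blocked only if \<open>a 1\<close> is a
  natural number \<open>t\<close>, and then \<open>t + 1\<close> slots have been reached.\<close>

lemma disk_eval_vanishes:
  fixes a :: "nat \<Rightarrow> 'k::field_char_0"
  assumes vanish: "\<And>x. alt_eval a {..<Suc d} x = 0"
  obtains t where "a 1 = of_nat t" "\<And>u. disk_eval a t u = 0"
proof -
  have down: "alt_eval a {..<Suc p} x = 0"
    if "p \<le> d" "\<And>i. p < i \<Longrightarrow> i \<le> d \<Longrightarrow> a 1 \<noteq> of_nat i" for p x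
    using that
  proof (induction arbitrary: x rule: inc_induct)
    case base
    show ?case by (rule vanish)
  next
    case (step p)
    have "alt_eval a (insert (Suc p) {..<Suc p}) (x(Suc p := 0)) = 
        (a 1 - of_nat (card {..<Suc p})) * alt_eval a {..<Suc p} (x(Suc p := 0))"
      by (rule alt_eval_identity_tube) auto
    moreover have "insert (Suc p) {..<Suc p} = {..<Suc (Suc p)}" by auto
    moreover have "alt_eval a {..<Suc (Suc p)} (x(Suc p := 0)) = 0" using step by simp
    moreover have "a 1 \<noteq> of_nat (card {..<Suc p})" using step.prems[of "Suc p"] step.hyps by simp
    ultimately have "alt_eval a {..<Suc p} (x(Suc p := 0)) = 0" by simp
    moreover have "alt_eval a {..<Suc p} (x(Suc p := 0)) = alt_eval a {..<Suc p} x"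
      by (rule alt_eval_cong) auto
    ultimately show ?case by simp
  qed
  have disk: "disk_eval a p u = 0" if "\<And>x. alt_eval a {..<Suc p} x = 0" for p u
  proof -
    have "alt_eval a (insert 0 {1..<Suc p}) (\<lambda>j. if j = 0 then u else 1) = disk_eval a p u"
      by (subst alt_eval_disk_tubes) auto
    moreover have "insert 0 {1..<Suc p} = {..<Suc p}" by auto
    ultimately show ?thesis using that by metis
  qed
  show thesis
  proof (cases "\<exists>t\<le>d. a 1 = of_nat t")
    case True
    then obtain t where t: "t \<le> d" "a 1 = of_nat t" by blast
    then have "alt_eval a {..<Suc t} x = 0" for x by (intro down) auto
    then show thesis using t disk that by blast
  next
    case False
    \<comment> \<open>Without such a \<open>t\<close> the descent reaches a single pair of disks, so
      every \<open>a u\<close> vanishes; but then \<open>a 1 = 0\<close> is the excluded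
      value.\<close>
    then have "alt_eval a {..<Suc 0} x = 0" for x by (intro down) auto
    then have "disk_eval a 0 u = 0" for u by (rule disk)
    then show thesis using False by (metis disk_eval.simps(1) le0 of_nat_0)
  qed
qed

section \<open>Newton's identities and the shape of the generating function\<close>

text \<open>Up to sign, the elementary symmetric functions of the eigenvalues of the handle operator.\<close>

definition char_coeff :: "(nat \<Rightarrow> 'k::field_char_0) \<Rightarrow> nat \<Rightarrow> 'k" where
  "char_coeff a n = (case n of 0 \<Rightarrow> 1 | Suc q \<Rightarrow> (-1) ^ n * disk_eval a q 2 / fact n)"

lemma char_coeff_0: "char_coeff a 0 = 1"
  by (simp add: char_coeff_def)

text \<open>The recursion of \<open>disk_eval\<close> unrolled, its factors \<open>Suc q\<close>
  being absorbed by the factorial. For \<open>q = t\<close> the right-hand side is L (x^u chi), so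
  its vanishing is the Cayley-Hamilton identity.\<close>

lemma disk_eval_eq_sum:
  fixes a :: "nat \<Rightarrow> 'k::field_char_0"
  shows "(-1) ^ q * disk_eval a q u / fact q = (\<Sum>i\<le>q. char_coeff a i * a (u + (q - i)))"
proof (induction q arbitrary: u)
  case 0
  then show ?case by (simp add: char_coeff_0)
next
  case (Suc q)
  have nz: "of_nat (Suc q) \<noteq> (0::'k)" by (simp only: of_nat_eq_0_iff)
  have "(-1) ^ Suc q * disk_eval a (Suc q) u / fact (Suc q) =
      char_coeff a (Suc q) * a u + (-1) ^ q * disk_eval a q (u + 1) / fact q"
    using nz by (simp add: char_coeff_def field_simps del: of_nat_Suc)
  also have "(-1) ^ q * disk_eval a q (u + 1) / fact q = (\<Sum>i\<le>q. char_coeff a i * a (u + (Suc q - i)))"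
    unfolding Suc.IH by (intro sum.cong refl) (simp add: Suc_diff_le)
  finally show ?case by simp
qed

text \<open>The case \<open>u = 2\<close> of \<open>disk_eval_eq_sum\<close>, because
  \<open>char_coeff a (Suc q)\<close> is itself a multiple of \<open>disk_eval a q 2\<close>. With
  \<open>a (k + 1)\<close> read as the k-th power sum this is Newton's identity.\<close>

lemma char_coeff_newton:
  "of_nat (Suc q) * char_coeff a (Suc q) = - (\<Sum>i\<le>q. char_coeff a i * a (2 + (q - i)))"
proof -
  have "of_nat (Suc q) \<noteq> (0::'a)" by (simp only: of_nat_eq_0_iff)
  then show ?thesis
    unfolding disk_eval_eq_sum[symmetric] by (simp add: char_coeff_def field_simps del: of_nat_Suc)
qed

text \<open>\<open>R\<close> is the reversed characteristic polynomial. Its equation packs Newton's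
  identities: coefficients up to \<open>t\<close> come from \<open>char_coeff_newton\<close>, a
  later one \<open>n\<close> from the vanishing at \<open>u = n + 1 - t\<close>. The equation sees
  only the \<open>a (g + 1)\<close>; the instance \<open>u = 0\<close>, where \<open>a 0\<close>
  enters, is the last claim.\<close>

lemma char_poly_exists:
  fixes a :: "nat \<Rightarrow> 'k::field_char_0"
  assumes t: "a 1 = of_nat t" and vanish: "\<And>u. disk_eval a t u = 0"
  obtains R :: "'k poly" where "coeff R 0 = 1" "degree R \<le> t"
    "fps_of_poly R * Abs_fps (\<lambda>g. a (g + 1)) =
       of_nat t * fps_of_poly R - fps_X * fps_deriv (fps_of_poly R)"
    "(fps_of_poly R * Abs_fps a) $ t = 0"
proof -
  define c where "c = char_coeff a"
  define R where "R = (\<Sum>j\<le>t. monom (c j) j)"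
  have coeff: "coeff R n = (if n \<le> t then c n else 0)" for n
    by (simp add: R_def coeff_sum)
  have rec: "(\<Sum>i\<le>t. c i * a (u + (t - i))) = 0" for u
    unfolding c_def disk_eval_eq_sum[symmetric] by (simp add: vanish)
  have "(fps_of_poly R * Abs_fps (\<lambda>g. a (g + 1))) $ n =
      (of_nat t * fps_of_poly R - fps_X * fps_deriv (fps_of_poly R)) $ n" for n
  proof -
    have lhs: "(fps_of_poly R * Abs_fps (\<lambda>g. a (g + 1))) $ n = (\<Sum>i\<le>n. coeff R i * a (n - i + 1))"
      by (simp add: fps_mult_nth atLeast0AtMost)
    have rhs: "(of_nat t * fps_of_poly R - fps_X * fps_deriv (fps_of_poly R)) $ n =
        (of_nat t - of_nat n) * coeff R n"
      by (cases n) (simp_all add: fps_of_nat[symmetric] algebra_simps del: fps_of_nat)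
    have "(\<Sum>i\<le>n. coeff R i * a (n - i + 1)) = (of_nat t - of_nat n) * coeff R n"
    proof (cases "n \<le> t")
      case True
      show ?thesis
      proof (cases n)
        case 0
        then show ?thesis using t by (simp add: coeff c_def char_coeff_0)
      next
        case (Suc q)
        have "(\<Sum>i\<le>n. coeff R i * a (n - i + 1)) = c n * of_nat t + (\<Sum>i\<le>q. c i * a (2 + (q - i)))"
          using True t by (simp add: Suc coeff Suc_diff_le)
        also have "(\<Sum>i\<le>q. c i * a (2 + (q - i))) = - (of_nat n * c n)"
          using char_coeff_newton[of q a] by (simp add: c_def Suc)
        finally show ?thesis using True by (simp add: coeff algebra_simps)
      qed
    next
      case False
      have "(\<Sum>i\<le>n. coeff R i * a (n - i + 1)) = (\<Sum>i\<le>t. coeff R i * a (n - i + 1))"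
        by (rule sum.mono_neutral_right) (use False in \<open>auto simp: coeff\<close>)
      also have "\<dots> = (\<Sum>i\<le>t. c i * a ((n + 1 - t) + (t - i)))"
        by (intro sum.cong refl) (use False in \<open>auto simp: coeff intro!: arg_cong[where f=a]\<close>)
      also have "\<dots> = 0" by (rule rec)
      finally show ?thesis using False by (simp add: coeff)
    qed
    then show ?thesis unfolding lhs rhs .
  qed
  then have A: "fps_of_poly R * Abs_fps (\<lambda>g. a (g + 1)) =
       of_nat t * fps_of_poly R - fps_X * fps_deriv (fps_of_poly R)"
    by (rule fps_ext)
  have Z: "(fps_of_poly R * Abs_fps a) $ t = 0"
    using rec[of 0] by (simp add: fps_mult_nth atLeast0AtMost coeff)
  have "degree R \<le> t" by (rule degree_le) (simp add: coeff)
  moreover have "coeff R 0 = 1" by (simp add: coeff c_def char_coeff_0)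
  ultimately show ?thesis using that A Z by blast
qed

section \<open>Linear factors and partial fractions\<close>

text \<open>Reflection turns the constant term 1 into the leading coefficient and the leading
  coefficient into the value at 0. So the reflected polynomial is monic with nonzero roots; it is
  split there and reflected back.\<close>

lemma factor_normalized_poly:
  fixes R :: "'k::alg_closed_field poly"
  assumes "coeff R 0 = 1"
  obtains lam :: "nat \<Rightarrow> 'k" where "R = (\<Prod>i<degree R. [:1, - lam i:])" "\<forall>i<degree R. lam i \<noteq> 0"
proof -
  define p where "p = reflect_poly R"
  have R: "reflect_poly p = R" using assms by (simp add: p_def)
  have "p \<noteq> 0" using assms by (auto simp: p_def)
  moreover have "lead_coeff p = 1" using assms by (simp add: p_def coeff_reflect_poly)
  moreover have deg: "degree p = degree R" using assms by (simp add: p_def)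
  ultimately obtain A where A: "size A = degree R" "p = (\<Prod>x\<in>#A. [:-x, 1:])"
    using alg_closed_imp_factorization[of p] by auto
  obtain xs where xs: "mset xs = A" using ex_mset by blast
  have len: "length xs = degree R" using A xs by auto
  have p: "p = (\<Prod>i<degree R. [:- (xs ! i), 1:])"
    unfolding A(2) xs[symmetric] mset_map[symmetric] prod_mset_prod_list
    by (simp add: prod.list_conv_set_nth len atLeast0LessThan)
  have "reflect_poly [:-x, 1:] = [:1, -x:]" for x :: 'k
    by (cases "x = 0") (simp_all add: reflect_poly_pCons reflect_poly_pCons' cCons_def)
  then have "R = (\<Prod>i<degree R. [:1, - (xs ! i):])"
    using R unfolding p reflect_poly_prod by simp
  moreover have "\<forall>i<degree R. xs ! i \<noteq> 0"
  proof -
    have "poly p 0 \<noteq> 0"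
      using assms by (auto simp: p_def)
    then show ?thesis by (auto simp: p poly_prod)
  qed
  ultimately show ?thesis using that by blast
qed

text \<open>Logarithmic derivative: each factor satisfies \<open>inverse f = 1 - X * f' / f\<close>.
  The right-hand side has the shape of the equation in \<open>char_poly_exists\<close>.\<close>

lemma prod_mult_sum_inverse_linear:
  fixes lam :: "nat \<Rightarrow> 'k::field"
  defines "f \<equiv> \<lambda>i. 1 - fps_const (lam i) * fps_X"
  shows "(\<Prod>i<r. f i) * (\<Sum>i<r. inverse (f i)) = of_nat r * (\<Prod>i<r. f i) - fps_X * fps_deriv (\<Prod>i<r. f i)"
proof (induction r)
  case (Suc r)
  have "inverse (f r) * f r = 1"
    by (rule inverse_mult_eq_1) (simp add: f_def)
  then have "(\<Prod>i<Suc r. f i) * (\<Sum>i<Suc r. inverse (f i)) =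
      f r * ((\<Prod>i<r. f i) * (\<Sum>i<r. inverse (f i))) + (\<Prod>i<r. f i)"
    by (simp add: algebra_simps)
  also have "\<dots> = f r * (of_nat r * (\<Prod>i<r. f i) - fps_X * fps_deriv (\<Prod>i<r. f i)) + (\<Prod>i<r. f i)"
    by (simp only: Suc.IH)
  also have "\<dots> = of_nat (Suc r) * (\<Prod>i<Suc r. f i) - fps_X * fps_deriv (\<Prod>i<Suc r. f i)"
    by (simp add: algebra_simps) (simp add: f_def algebra_simps flip: fps_const_neg)
  finally show ?case .
qed simp

lemma inverse_linear_nth: "inverse (1 - fps_const (c::'k::field) * fps_X) $ n = c ^ n"
proof -
  have "(1 - fps_const c * fps_X) * Abs_fps (\<lambda>n. c ^ n) = 1"
  proof (rule fps_ext)
    show "((1 - fps_const c * fps_X) * Abs_fps (\<lambda>n. c ^ n)) $ n = 1 $ n" for n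
      by (cases n) (simp_all add: left_diff_distrib mult.assoc)
  qed
  then show ?thesis by (metis fps_inverse_unique fps_nth_Abs_fps)
qed

lemma genus_formula:
  fixes a :: "nat \<Rightarrow> 'k::{alg_closed_field, field_char_0}"
  assumes t: "a 1 = of_nat t" and vanish: "\<And>u. disk_eval a t u = 0"
  obtains \<mu> :: 'k and m r :: nat and lam :: "nat \<Rightarrow> 'k"
  where "\<forall>i<r. lam i \<noteq> 0" "m \<noteq> 1" "m = 0 \<longrightarrow> \<mu> = 0"
    "\<And>g. a g = (if g = 0 then \<mu> else 0) + (if g = 1 then of_nat m else 0) + (\<Sum>i<r. lam i ^ g / lam i)"
proof -
  obtain R :: "'k poly" where R0: "coeff R 0 = 1" and deg: "degree R \<le> t" and
    RA: "fps_of_poly R * Abs_fps (\<lambda>g. a (g + 1)) =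
       of_nat t * fps_of_poly R - fps_X * fps_deriv (fps_of_poly R)" and
    RZ: "(fps_of_poly R * Abs_fps a) $ t = 0"
    using char_poly_exists[OF t vanish] by metis
  define r where "r = degree R"
  \<comment> \<open>Of the \<open>t\<close> eigenvalues, \<open>r\<close> are nonzero;
    \<open>m\<close> counts the eigenvalue 0.\<close>
  define m where "m = t - r"
  have tm: "t = m + r" using deg by (simp add: m_def r_def)
  obtain lam where R: "R = (\<Prod>i<r. [:1, - lam i:])" and lam: "\<forall>i<r. lam i \<noteq> 0"
    using factor_normalized_poly[OF R0] unfolding r_def by metis
  define f where "f i = 1 - fps_const (lam i) * fps_X" for i
  have lin: "fps_of_poly [:1, - lam i:] = f i" for i
    by (simp add: fps_of_poly_linear' f_def)
  have Rf: "fps_of_poly R = (\<Prod>i<r. f i)"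
    by (subst R) (simp add: fps_of_poly_prod lin)
  \<comment> \<open>Comparing the two Newton equations leaves \<open>t - r = m\<close> copies of
    \<open>R\<close>. Then \<open>R\<close>, having constant term 1, cancels.\<close>
  have "fps_of_poly R * Abs_fps (\<lambda>g. a (g + 1)) = fps_of_poly R * (of_nat m + (\<Sum>i<r. inverse (f i)))"
    unfolding RA using prod_mult_sum_inverse_linear[where lam = lam and r = r]
    by (simp add: Rf f_def tm algebra_simps)
  moreover have "fps_of_poly R \<noteq> 0" using R0 by (metis fps_of_poly_nth fps_zero_nth zero_neq_one)
  ultimately have A: "Abs_fps (\<lambda>g. a (g + 1)) = of_nat m + (\<Sum>i<r. inverse (f i))" by simp
  have pos: "a (Suc g) = (if g = 0 then of_nat m else 0) + (\<Sum>i<r. lam i ^ g)" for g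
    using arg_cong[OF A, of "\<lambda>F. F $ g"]
    by (simp add: f_def inverse_linear_nth fps_sum_nth fps_of_nat[symmetric] del: fps_of_nat)
  \<comment> \<open>The power sums say nothing about \<open>a 0\<close>; \<open>\<mu>\<close> is its
    deviation from their pattern continued to genus 0.\<close>
  define \<mu> where "\<mu> = a 0 - (\<Sum>i<r. 1 / lam i)"
  have val: "a g = (if g = 0 then \<mu> else 0) + (if g = 1 then of_nat m else 0) + (\<Sum>i<r. lam i ^ g / lam i)" for g
    using lam by (cases g) (auto simp: \<mu>_def pos intro!: sum.cong)
  \<comment> \<open>\<open>R\<close> without its \<open>i\<close>-th factor: the degree is below
    \<open>t\<close>, so the partial fractions do not reach the coefficient at
    \<open>t\<close>.\<close>
  define Q where "Q i = (\<Prod>l\<in>{..<r} - {i}. [:1, - lam l:])" for i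
  have RQ: "fps_of_poly R * inverse (f i) = fps_of_poly (Q i)" if "i < r" for i
  proof -
    have "f i * inverse (f i) = 1"
      using inverse_mult_eq_1[of "f i"] by (simp add: f_def mult.commute)
    moreover have "fps_of_poly R = f i * fps_of_poly (Q i)"
      using that unfolding Rf Q_def by (simp add: fps_of_poly_prod lin prod.remove[of _ i])
    ultimately show ?thesis by (simp add: mult_ac)
  qed
  have "Abs_fps a = fps_const \<mu> + fps_const (of_nat m) * fps_X + (\<Sum>i<r. fps_const (1 / lam i) * inverse (f i))"
    by (rule fps_ext) (simp add: val f_def inverse_linear_nth fps_sum_nth)
  then have "fps_of_poly R * Abs_fps a =
      fps_of_poly (smult \<mu> R + smult (of_nat m) (pCons 0 R) + (\<Sum>i<r. smult (1 / lam i) (Q i)))"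
    by (simp add: fps_of_poly_simps algebra_simps sum_distrib_left RQ[symmetric] fps_of_poly_pCons fps_of_poly_smult)
  with RZ have "coeff (smult \<mu> R + smult (of_nat m) (pCons 0 R) + (\<Sum>i<r. smult (1 / lam i) (Q i))) t = 0"
    by simp
  moreover have "coeff (Q i) t = 0" if "i < r" for i
  proof (rule coeff_eq_0)
    have "degree (Q i) \<le> (\<Sum>l\<in>{..<r} - {i}. degree [:1, - lam l:])"
      unfolding Q_def using degree_prod_sum_le[of "{..<r} - {i}" "\<lambda>l. [:1, - lam l:]"] by (simp add: o_def)
    also have "\<dots> \<le> (\<Sum>l\<in>{..<r} - {i}. 1)" by (intro sum_mono) (simp add: degree_pCons_le)
    also have "\<dots> < t" using that by (simp add: tm)
    finally show "degree (Q i) < t" .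
  qed
  \<comment> \<open>The condition at the eigenvalue 0. For \<open>t = r + 1\<close> it leaves just
    the leading coefficient of \<open>R\<close>, for \<open>t = r\<close> just \<open>\<mu>\<close>
    times it.\<close>
  ultimately have top: "\<mu> * coeff R t + of_nat m * coeff (pCons 0 R) t = 0"
    by (simp add: coeff_sum del: smult_pCons)
  have lead: "coeff R r \<noteq> 0" using R0 unfolding r_def by auto
  have "m \<noteq> 1"
    using top lead coeff_eq_0[of R "Suc r"] by (auto simp: tm r_def)
  moreover have "\<mu> = 0" if "m = 0"
    using top lead that by (simp add: tm)
  ultimately show ?thesis using that lam val by blast
qed

section \<open>The Frobenius algebra\<close>

text \<open>A local algebra of dimension \<open>m\<close> times \<open>r\<close> copies of the
  field. The local handle element is \<open>m\<close> times the socle generator and squares to zero,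
  so this factor adds only \<open>\<mu>\<close> at genus 0 and \<open>m\<close> at genus 1. An
  idempotent of counit \<open>1 / lam i\<close> has handle element \<open>lam i\<close> times
  itself.\<close>

lemma frobenius_exists:
  fixes lam :: "nat \<Rightarrow> 'k::field" and \<mu> :: 'k
  assumes lam: "\<forall>i<r. lam i \<noteq> 0" and m: "m \<noteq> 1" and \<mu>: "m = 0 \<longrightarrow> \<mu> = 0"
  shows "\<exists>n (c :: nat \<Rightarrow> nat \<Rightarrow> nat \<Rightarrow> 'k) e t h. comm_frobenius n c e t \<and> is_handle n c t h \<and>
    (\<forall>g. (if g = 0 then \<mu> else 0) + (if g = 1 then of_nat m else 0) + (\<Sum>i<r. lam i ^ g / lam i) =
      fa_eps n t (fa_pow n c e h g))"
proof -
  txt \<open>Coordinate \<open>0\<close> is the unit of the local part, \<open>1\<close> spans its socle, \<open>2..<m\<close> is an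
    orthonormal family with products in the socle, and \<open>m..<m + r\<close> are orthogonal idempotents.\<close>
  let ?n = "m + r"
  define c :: "nat \<Rightarrow> nat \<Rightarrow> nat \<Rightarrow> 'k" where
    "c i j l = (if m \<le> l then of_bool (i = l \<and> j = l)
      else if l = 0 then of_bool (i = 0 \<and> j = 0)
      else if l = 1 then of_bool (i = 0 \<and> j = 1) + of_bool (i = 1 \<and> j = 0) + of_bool (i \<in> {2..<m} \<and> j = i)
      else of_bool (i = 0 \<and> j = l) + of_bool (i = l \<and> j = 0))" for i j l
  define e :: "nat \<Rightarrow> 'k" where "e l = of_bool (l < ?n \<and> (m \<le> l \<or> l = 0))" for l
  define t :: "nat \<Rightarrow> 'k" where
    "t l = (if m \<le> l then 1 / lam (l - m) else if l = 0 then \<mu> else of_bool (l = 1))" for l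
  \<comment> \<open>The dual basis: unit and socle generator are exchanged, and the term with
    \<open>\<mu>\<close> corrects for the counit of the local unit being
    \<open>\<mu>\<close>.\<close>
  define v :: "nat \<Rightarrow> nat \<Rightarrow> 'k" where
    "v j l = (if m \<le> j then (if l = j then lam (j - m) else 0)
      else if j = 0 then of_bool (l = 1)
      else if j = 1 then of_bool (l = 0) - \<mu> * of_bool (l = 1)
      else of_bool (l = j))" for j l
  define h where "h l = (\<Sum>i<?n. fa_mul ?n c (basis_vec i) (v i) l)" for l
  define D where "D x y = (\<Sum>i\<in>{2..<m}. x i * y i)" for x y :: "nat \<Rightarrow> 'k"

  \<comment> \<open>As \<open>m\<close> is not 1, any local index forces both the unit
    \<open>0\<close> and the socle \<open>1\<close> to be local.\<close>
  have m2: "2 \<le> m" if "l < m" for l using that m by linarith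
  have m_le_1: "m \<le> Suc 0 \<longleftrightarrow> m = 0" using m by linarith
  have split: "(\<Sum>i<m + r. f i) = (\<Sum>i<m. f i) + (\<Sum>i<r. f (m + i))" for f :: "nat \<Rightarrow> 'k"
    by (induction r) (simp_all add: add.assoc)
  have single: "(\<Sum>i<?n. \<Sum>j<?n. x i * y j * of_bool (i = p \<and> j = q)) = x p * y q"
    if "p < ?n" "q < ?n" for x y :: "nat \<Rightarrow> 'k" and p q
  proof -
    have "(\<Sum>i<?n. \<Sum>j<?n. x i * y j * of_bool (i = p \<and> j = q)) =
        (\<Sum>i<?n. \<Sum>j<?n. if j = q then (if i = p then x i * y j else 0) else 0)"
      by (intro sum.cong refl) auto
    also have "\<dots> = x p * y q" using that by (simp add: sum.delta)
    finally show ?thesis .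
  qed
  have diag: "(\<Sum>i<?n. \<Sum>j<?n. x i * y j * of_bool (i \<in> {2..<m} \<and> j = i)) = D x y" for x y
  proof -
    have "(\<Sum>i<?n. \<Sum>j<?n. x i * y j * of_bool (i \<in> {2..<m} \<and> j = i)) =
        (\<Sum>i<?n. \<Sum>j<?n. if j = i then (if i \<in> {2..<m} then x i * y j else 0) else 0)"
      by (intro sum.cong refl) auto
    also have "\<dots> = (\<Sum>i<?n. if i \<in> {2..<m} then x i * y i else 0)"
      by (intro sum.cong refl) simp
    also have "\<dots> = D x y"
      unfolding D_def by (rule sum.mono_neutral_cong_right) auto
    finally show ?thesis .
  qed
  have mul: "fa_mul ?n c x y l = (if ?n \<le> l then 0 else if m \<le> l then x l * y l
      else if l = 0 then x 0 * y 0
      else if l = 1 then x 0 * y 1 + x 1 * y 0 + D x y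
      else x 0 * y l + x l * y 0)" for x y l
  proof -
    consider "?n \<le> l" | "l < ?n" "m \<le> l" | "l = 0" "l < m" | "l = 1" "l < m" | "2 \<le> l" "l < m"
      by linarith
    then show ?thesis
    proof cases
      case 1 then show ?thesis by (simp add: fa_mul_def)
    next
      case 2 then show ?thesis using single[of l l x y] by (simp add: fa_mul_def c_def)
    next
      case 3 then show ?thesis using single[of 0 0 x y] by (simp add: fa_mul_def c_def)
    next
      case 4
      then show ?thesis using single[of 0 1 x y] single[of 1 0 x y] diag[of x y]
        by (simp add: fa_mul_def c_def distrib_left sum.distrib)
    next
      case 5
      then show ?thesis using single[of 0 l x y] single[of l 0 x y]
        by (simp add: fa_mul_def c_def distrib_left sum.distrib)
    qed
  qed
  have eps: "fa_eps ?n t x = (if m = 0 then 0 else \<mu> * x 0 + x 1) + (\<Sum>i<r. x (m + i) / lam i)" for x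
  proof -
    have "fa_eps ?n t x = (\<Sum>l<m. t l * x l) + (\<Sum>i<r. t (m + i) * x (m + i))"
      unfolding fa_eps_def by (simp add: split)
    moreover have "(\<Sum>l<m. t l * x l) = \<mu> * x 0 + x 1" if "m \<noteq> 0"
    proof -
      have "(\<Sum>l<m. t l * x l) = (\<Sum>l\<in>{0, 1}. t l * x l)"
        by (rule sum.mono_neutral_right) (use that m in \<open>auto simp: t_def\<close>)
      then show ?thesis using that m by (simp add: t_def)
    qed
    ultimately show ?thesis by (auto simp: t_def)
  qed
  have comm: "fa_mul ?n c x y = fa_mul ?n c y x" for x y
    by (rule ext) (auto simp: mul D_def algebra_simps)
  have assoc: "fa_mul ?n c (fa_mul ?n c x y) z = fa_mul ?n c x (fa_mul ?n c y z)" for x y z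
  proof (rule ext)
    fix l
    have D1: "D (fa_mul ?n c x y) z = x 0 * D y z + y 0 * D x z" for x y z
      unfolding D_def sum_distrib_left sum.distrib[symmetric]
      by (intro sum.cong refl) (auto simp: mul algebra_simps)
    have D2: "D x y = D y x" for x y by (simp add: D_def mult.commute)
    show "fa_mul ?n c (fa_mul ?n c x y) z l = fa_mul ?n c x (fa_mul ?n c y z) l"
      using D1[of x y z] D1[of y z x] D2[of x "fa_mul ?n c y z"] D2[of x y] D2[of x z]
      by (auto simp: mul algebra_simps)
  qed
  have unit: "fa_mul ?n c e x = x" if "vec_on ?n x" for x
  proof (rule ext)
    fix l
    have "D e x = 0" by (simp add: D_def e_def)
    then show "fa_mul ?n c e x l = x l"
      using that m2 by (auto simp: mul e_def vec_on_def)
  qed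
  \<comment> \<open>The Frobenius pairing in coordinates; it yields both nondegeneracy and the
    duality of \<open>v\<close>.\<close>
  have eps_basis: "fa_eps ?n t (fa_mul ?n c x (basis_vec l)) =
      (if m \<le> l then x l / lam (l - m) else if l = 0 then \<mu> * x 0 + x 1 else if l = 1 then x 0 else x l)"
    if l: "l < ?n" for x l
  proof -
    have D: "D x (basis_vec l) = (if l \<in> {2..<m} then x l else 0)"
      by (simp add: D_def basis_vec_def sum.delta' if_distrib cong: if_cong)
    have idem: "(\<Sum>i<r. fa_mul ?n c x (basis_vec l) (m + i) / lam i) = (if m \<le> l then x l / lam (l - m) else 0)"
    proof -
      have "(\<Sum>i<r. fa_mul ?n c x (basis_vec l) (m + i) / lam i) =
          (\<Sum>i<r. if i = l - m then (if m \<le> l then x l / lam (l - m) else 0) else 0)"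
        by (intro sum.cong refl) (auto simp: mul basis_vec_def)
      also have "\<dots> = (if m \<le> l then x l / lam (l - m) else 0)"
        using l by (auto simp: sum.delta)
      finally show ?thesis .
    qed
    show ?thesis
      unfolding eps idem using l m D
      by (auto simp: mul basis_vec_def)
  qed
  have nondeg: "x = (\<lambda>_. 0)"
    if x: "vec_on ?n x" and z: "\<forall>y. vec_on ?n y \<longrightarrow> fa_eps ?n t (fa_mul ?n c x y) = 0" for x
  proof (rule ext)
    have "vec_on ?n (basis_vec l :: nat \<Rightarrow> 'k)" if "l < ?n" for l
      using that by (auto simp: vec_on_def basis_vec_def)
    then have b: "fa_eps ?n t (fa_mul ?n c x (basis_vec l)) = 0" if "l < ?n" for l using z that by blast
    fix l
    consider "?n \<le> l" | "l < ?n" "m \<le> l" | "l < m" by linarith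
    then show "x l = 0"
    proof cases
      case 1 then show ?thesis using x by (simp add: vec_on_def)
    next
      case 2 then show ?thesis using b[of l] lam by (auto simp: eps_basis)
    next
      case 3
      then have "x 0 = 0" "\<mu> * x 0 + x 1 = 0" using b[of 1] b[of 0] m2[of l] by (auto simp: eps_basis)
      then show ?thesis using 3 b[of l] by (cases "l = 0"; cases "l = 1") (auto simp: eps_basis)
    qed
  qed
  have frob: "comm_frobenius ?n c e t"
    unfolding comm_frobenius_def using assoc unit nondeg
    by (auto simp: vec_on_def e_def c_def)
  have "fa_eps ?n t (fa_mul ?n c (basis_vec i) (v j)) = (if i = j then 1 else 0)" if "i < ?n" "j < ?n" for i j
    unfolding comm[of "basis_vec i"] eps_basis[OF that(1)]
    using that lam by (auto simp: v_def m_le_1)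
  moreover have "vec_on ?n (v i)" if "i < ?n" for i
    using that m2[of i] by (auto simp: vec_on_def v_def)
  ultimately have hdl: "is_handle ?n c t h"
    unfolding is_handle_def h_def[abs_def] by (intro exI[of _ v]) auto
  \<comment> \<open>Each of the \<open>m\<close> local basis vectors times its dual is the socle
    generator.\<close>
  have h: "h l = (if ?n \<le> l then 0 else if m \<le> l then lam (l - m) else if l = 1 then of_nat m else 0)" for l
  proof -
    have summand: "fa_mul ?n c (basis_vec i) (v i) l =
        (if m \<le> i then (if l = i then lam (i - m) else 0) else of_bool (l = 1))" if i: "i < ?n" for i
    proof -
      have "D (basis_vec i) (v i) = of_bool (i \<in> {2..<m})"
      proof -
        have "D (basis_vec i) (v i) = (\<Sum>j\<in>{2..<m}. if j = i then v i i else 0)"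
          unfolding D_def by (intro sum.cong refl) (auto simp: basis_vec_def)
        then show ?thesis by (auto simp: sum.delta v_def)
      qed
      then show ?thesis using i m2[of i] by (auto simp: mul basis_vec_def v_def m_le_1)
    qed
    have "h l = (\<Sum>i<m. of_bool (l = 1)) + (\<Sum>i<r. if l = m + i then lam i else 0)"
      unfolding h_def split by (intro arg_cong2[where f = plus] sum.cong refl) (simp_all add: summand)
    moreover have "(\<Sum>i<r. if l = m + i then lam i else 0) = (\<Sum>i<r. if i = l - m then of_bool (m \<le> l) * lam i else 0)"
      by (intro sum.cong refl) auto
    moreover have "m = 0 \<or> 2 \<le> m" using m by linarith
    ultimately show ?thesis by (elim disjE) (auto simp: sum.delta)
  qed
  have pow: "fa_pow ?n c e h g l = (if ?n \<le> l then 0 else if m \<le> l then lam (l - m) ^ g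
      else if l = 0 then of_bool (g = 0) else if l = 1 then of_bool (g = 1) * of_nat m else 0)" for g l
  proof (induction g arbitrary: l)
    case 0
    then show ?case by (auto simp: fa_pow_def e_def)
  next
    case (Suc g)
    define P where "P = fa_pow ?n c e h g"
    have D0: "D h P = 0" by (simp add: D_def h)
    have step: "fa_pow ?n c e h (Suc g) = fa_mul ?n c h P" by (simp add: fa_pow_def P_def)
    have P: "P l = (if ?n \<le> l then 0 else if m \<le> l then lam (l - m) ^ g
      else if l = 0 then of_bool (g = 0) else if l = 1 then of_bool (g = 1) * of_nat m else 0)" for l
      unfolding P_def by (rule Suc.IH)
    show ?case unfolding step mul D0 using m2[of l] by (auto simp: h P)
  qed
  have "(if g = 0 then \<mu> else 0) + (if g = 1 then of_nat m else 0) + (\<Sum>i<r. lam i ^ g / lam i) =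
      fa_eps ?n t (fa_pow ?n c e h g)" for g
  proof -
    have "(\<Sum>i<r. fa_pow ?n c e h g (m + i) / lam i) = (\<Sum>i<r. lam i ^ g / lam i)"
      by (intro sum.cong refl) (simp add: pow)
    then show ?thesis unfolding eps using m \<mu> by (auto simp: pow)
  qed
  with frob hdl show ?thesis by blast
qed

theorem mainTheorem14:
  fixes a :: "nat \<Rightarrow> 'k::{alg_closed_field, field_char_0}"
  assumes "pseudocharacter a"
  shows "((\<exists>(\<mu>::'k) (m::nat) (s::nat) (ms::nat \<Rightarrow> nat) (lam::nat \<Rightarrow> 'k).
             m \<ge> 2 \<and> (\<forall>i<s. ms i \<ge> 1 \<and> lam i \<noteq> 0) \<and>
             Abs_fps a = fps_const \<mu> + fps_const (of_nat m) * fps_X +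
               (\<Sum>i<s. fps_const (of_nat (ms i) / lam i) * inverse (1 - fps_const (lam i) * fps_X)))
         \<or> (\<exists>(s::nat) (ms::nat \<Rightarrow> nat) (lam::nat \<Rightarrow> 'k).
             (\<forall>i<s. ms i \<ge> 1 \<and> lam i \<noteq> 0) \<and>
             Abs_fps a =
               (\<Sum>i<s. fps_const (of_nat (ms i) / lam i) * inverse (1 - fps_const (lam i) * fps_X))))
      \<and> (\<exists>(n::nat) (c::nat \<Rightarrow> nat \<Rightarrow> nat \<Rightarrow> 'k) e t h.
           comm_frobenius n c e t \<and> is_handle n c t h \<and>
           (\<forall>g. a g = fa_eps n t (fa_pow n c e h g)))"
proof -
  obtain d where "\<And>x. alt_eval a {..<Suc d} x = 0"
    using pseudocharacter_alt_eval[OF assms] by blast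
  then obtain t where t: "a 1 = of_nat t" and vanish: "\<And>u. disk_eval a t u = 0"
    using disk_eval_vanishes by blast
  obtain \<mu> :: 'k and m r :: nat and lam :: "nat \<Rightarrow> 'k"
    where lam: "\<forall>i<r. lam i \<noteq> 0" and m: "m \<noteq> 1" and \<mu>: "m = 0 \<longrightarrow> \<mu> = 0"
    and a: "\<And>g. a g = (if g = 0 then \<mu> else 0) + (if g = 1 then of_nat m else 0) + (\<Sum>i<r. lam i ^ g / lam i)"
    by (rule genus_formula[OF t vanish]) (rule that; assumption)
  \<comment> \<open>Eigenvalues are listed with repetition, so every multiplicity is taken to be
    1.\<close>
  have Z: "Abs_fps a = fps_const \<mu> + fps_const (of_nat m) * fps_X +
      (\<Sum>i<r. fps_const (of_nat 1 / lam i) * inverse (1 - fps_const (lam i) * fps_X))"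
    by (rule fps_ext) (simp add: a inverse_linear_nth fps_sum_nth)
  have "\<exists>n c e t h. comm_frobenius n c e t \<and> is_handle n c t h \<and>
      (\<forall>g. a g = fa_eps n t (fa_pow n c e h g))"
    unfolding a by (rule frobenius_exists[OF lam m \<mu>])
  moreover {
    assume "m \<ge> 2"
    have "\<exists>\<mu> m (s::nat) ms lam. m \<ge> 2 \<and> (\<forall>i<s. ms i \<ge> (1::nat) \<and> lam i \<noteq> 0) \<and>
        Abs_fps a = fps_const \<mu> + fps_const (of_nat m) * fps_X +
          (\<Sum>i<s. fps_const (of_nat (ms i) / lam i) * inverse (1 - fps_const (lam i) * fps_X))"
      by (rule exI[of _ \<mu>], rule exI[of _ m], rule exI[of _ r], rule exI[of _ "\<lambda>_. 1"], rule exI[of _ lam])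
        (use lam Z \<open>m \<ge> 2\<close> in simp)
  }
  moreover {
    assume "m = 0"
    have "\<exists>(s::nat) ms lam. (\<forall>i<s. ms i \<ge> (1::nat) \<and> lam i \<noteq> 0) \<and>
        Abs_fps a = (\<Sum>i<s. fps_const (of_nat (ms i) / lam i) * inverse (1 - fps_const (lam i) * fps_X))"
      by (rule exI[of _ r], rule exI[of _ "\<lambda>_. 1"], rule exI[of _ lam])
        (use lam Z \<mu> \<open>m = 0\<close> in simp)
  }
  moreover have "m \<ge> 2 \<or> m = 0" using m by linarith
  ultimately show ?thesis by blast
qed

end
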